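(* Let $S(x,p)=\sum_{n\ge1}x^n\sum_{w\in\mathcal{M}_n}p^{\mathrm{sper}(w)}$ be the generating function for the number of nonempty Motzkin polyominoes according to the length and the semiperimeter. Then $$S(x,p)=\frac{1 - p^2 x-\sqrt{1 - 2 p^2 x - 4 p^3 x^2 + p^4 x^2}}{2px}.$$
   Context: A Motzkin word of length $n\ge 1$ is a word $w=w_1\cdots w_n$ over the positive integers such that $w_1=1$, and $1\le w_k\le w_{k-1}+1$ and $w_{k-1}\ne w_k$ for $k=2,\dots,n$; $\mathcal{M}_n$ is the set of Motzkin words of length $n$. To $w$ one associates the Motzkin polyomino $P(w)$ of length $n$ with $n$ columns, all bottom-justified, whose $i$-th column consists of $w_i$ unit cells. The perimeter of $P(w)$ is the number of (unit) cell borders that do not touch another cell of $P(w)$, and the semiperimeter $\mathrm{sper}(w)$ is half of the perimeter. *)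

theory Defs
  imports "HOL-Computational_Algebra.Computational_Algebra"
begin

(* The letters w_1 ... w_n are w ! 0, ..., w ! (n - 1). *)
definition motzkin_words :: "nat \<Rightarrow> nat list set" where
  "motzkin_words n =
     {w. 1 \<le> n \<and> length w = n \<and> w ! 0 = 1 \<and>
         (\<forall>k. 1 \<le> k \<and> k < n \<longrightarrow>
            1 \<le> w ! k \<and> w ! k \<le> w ! (k - 1) + 1 \<and> w ! (k - 1) \<noteq> w ! k)}"

lemma motzkin_words_nth_le:
  assumes "w \<in> motzkin_words n" "k < n"
  shows "w ! k \<le> k + 1"
  using assms(2)
proof (induction k)
  case 0
  then show ?case using assms(1) by (simp add: motzkin_words_def)
next
  case (Suc k)
  have "w ! Suc k \<le> w ! (Suc k - 1) + 1"
    using assms(1) Suc.prems unfolding motzkin_words_def by fastforce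
  with Suc show ?case by simp
qed

lemma finite_motzkin_words: "finite (motzkin_words n)"
proof (rule finite_subset)
  show "motzkin_words n \<subseteq> {w. set w \<subseteq> {..n} \<and> length w = n}"
  proof (intro subsetI CollectI conjI)
    fix w y assume w: "w \<in> motzkin_words n" and "y \<in> set w"
    then obtain k where "k < length w" "y = w ! k" by (auto simp: in_set_conv_nth)
    with motzkin_words_nth_le[OF w, of k] w show "y \<in> {..n}"
      by (auto simp: motzkin_words_def)
  qed (auto simp: motzkin_words_def)
  show "finite {w. set w \<subseteq> {..n} \<and> length w = n}"
    by (rule finite_lists_length_eq) simp
qed

(* The pair (i, j) is the unit cell [i, i+1] x [j, j+1] of the plane. *)
type_synonym cell = "int \<times> int"

(* Hor i j is the segment from (i, j) to (i+1, j), Ver i j the segment from (i, j) to (i, j+1). *)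
datatype unit_segment = Hor int int | Ver int int

fun cell_borders :: "cell \<Rightarrow> unit_segment set" where
  "cell_borders (i, j) = {Hor i j, Hor i (j + 1), Ver i j, Ver (i + 1) j}"

definition perimeter :: "cell set \<Rightarrow> nat" where
  "perimeter C =
     card {e. \<exists>c\<in>C. e \<in> cell_borders c \<and> (\<forall>c'\<in>C. c' \<noteq> c \<longrightarrow> e \<notin> cell_borders c')}"

definition polyomino :: "nat list \<Rightarrow> cell set" where
  "polyomino w = {(int i, int j) | i j. i < length w \<and> j < w ! i}"

(* The division is exact, see even_perimeter and finite_polyomino. *)
definition semiperimeter :: "nat list \<Rightarrow> nat" where
  "semiperimeter w = perimeter (polyomino w) div 2"

lemma finite_polyomino: "finite (polyomino w)"
proof (rule finite_subset)
  show "polyomino w \<subseteq> (\<Union>i<length w. (\<lambda>j. (int i, int j)) ` {..<w ! i})"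
    by (auto simp: polyomino_def)
qed simp

lemma even_card_sym_diff:
  assumes "finite A" "finite B" "card A = card B"
  shows "even (card ((A - B) \<union> (B - A)))"
proof -
  have "card (A - B) = card (B - A)"
    using assms by (metis card_Diff_subset_Int finite_Int inf_commute)
  moreover have "card ((A - B) \<union> (B - A)) = card (A - B) + card (B - A)"
    using assms by (intro card_Un_disjoint) auto
  ultimately show ?thesis by simp
qed

lemma even_perimeter:
  assumes "finite C"
  shows "even (perimeter C)"
proof -
  define up where "up = (\<lambda>(i, j). (i, j + 1)) ` C"
  define right where "right = (\<lambda>(i, j). (i + 1, j)) ` C"
  define hor where "hor = (C - up) \<union> (up - C)"
  define ver where "ver = (C - right) \<union> (right - C)"
  have cu: "card up = card C" unfolding up_def by (rule card_image) (auto simp: inj_on_def)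
  have cr: "card right = card C" unfolding right_def by (rule card_image) (auto simp: inj_on_def)
  have fin: "finite up" "finite right" using assms by (auto simp: up_def right_def)
  have eh: "even (card hor)"
    unfolding hor_def using assms fin cu by (intro even_card_sym_diff) auto
  have ev: "even (card ver)"
    unfolding ver_def using assms fin cr by (intro even_card_sym_diff) auto
  have up: "(i, j) \<in> up \<longleftrightarrow> (i, j - 1) \<in> C" for i j
    unfolding up_def by (force simp: image_iff)
  have right: "(i, j) \<in> right \<longleftrightarrow> (i - 1, j) \<in> C" for i j
    unfolding right_def by (force simp: image_iff)
  let ?B = "{e. \<exists>c\<in>C. e \<in> cell_borders c \<and> (\<forall>c'\<in>C. c' \<noteq> c \<longrightarrow> e \<notin> cell_borders c')}"
  have cell_Hor: "Hor i j \<in> cell_borders c \<longleftrightarrow> c = (i, j) \<or> c = (i, j - 1)" for i j c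
    by (cases c) auto
  have cell_Ver: "Ver i j \<in> cell_borders c \<longleftrightarrow> c = (i, j) \<or> c = (i - 1, j)" for i j c
    by (cases c) auto
  have "Hor i j \<in> ?B \<longleftrightarrow> (i, j) \<in> hor" for i j
    unfolding hor_def Un_iff Diff_iff up mem_Collect_eq cell_Hor by auto
  moreover have "Ver i j \<in> ?B \<longleftrightarrow> (i, j) \<in> ver" for i j
    unfolding ver_def Un_iff Diff_iff right mem_Collect_eq cell_Ver by auto
  ultimately have mem: "e \<in> ?B \<longleftrightarrow>
      (case e of Hor i j \<Rightarrow> (i, j) \<in> hor | Ver i j \<Rightarrow> (i, j) \<in> ver)" for e
    by (simp split: unit_segment.split)
  have B: "?B = (\<lambda>(i, j). Hor i j) ` hor \<union> (\<lambda>(i, j). Ver i j) ` ver"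
    by (rule set_eqI, unfold mem) (auto split: unit_segment.splits intro: rev_image_eqI)
  have "card ?B = card ((\<lambda>(i, j). Hor i j) ` hor) + card ((\<lambda>(i, j). Ver i j) ` ver)"
    unfolding B using assms fin by (intro card_Un_disjoint) (auto simp: hor_def ver_def)
  also have "\<dots> = card hor + card ver"
    by (intro arg_cong2[where f = "(+)"] card_image) (auto simp: inj_on_def)
  finally show ?thesis using eh ev by (simp add: perimeter_def)
qed

(* Formal power series in x = fps_X over the field Q(p) of rational functions, so that division
   by 2px makes sense; p_var is the indeterminate p. Division by fps_X drops the constant
   coefficient of the numerator, so a quotient by 2px is exact only if that coefficient is 0. *)
definition p_var :: "rat poly fract" where
  "p_var = to_fract [:0, 1:]"

definition motzkin_sper_gf :: "rat poly fract fps" where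
  "motzkin_sper_gf =
     Abs_fps (\<lambda>n. if n = 0 then 0 else \<Sum>w\<in>motzkin_words n. p_var ^ semiperimeter w)"

(* The square root with constant coefficient 1; only meaningful for series with constant
   coefficient 1. *)
definition fps_sqrt :: "'a::field_char_0 fps \<Rightarrow> 'a fps" where
  "fps_sqrt f = fps_radical (\<lambda>_ _. 1) 2 f"

lemma fps_sqrt_nth_0: "fps_sqrt f $ 0 = 1"
  by (simp add: fps_sqrt_def)

lemma fps_sqrt_power2:
  assumes "f $ 0 = 1"
  shows "fps_sqrt f ^ 2 = f"
  using power_radical[of f "\<lambda>_ _. 1" 1] assms by (simp add: fps_sqrt_def numeral_2_eq_2)

end

theory Submission
  imports Defs
begin

text \<open>
  The formula is the solution of a quadratic equation for \<open>S\<close> that comes from cutting a word at its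
  second letter \<open>1\<close>. A Motzkin word other than \<open>[1]\<close> is uniquely \<open>1 # map Suc u @ v\<close>, where \<open>u\<close> is a
  Motzkin word and \<open>v\<close> is a Motzkin word or empty (\<open>motzkin_words_Suc\<close>,
  \<open>inj_on_arch_append\<close>).

  To see how the semiperimeter behaves under the cut, note that it is the number of columns plus
  the total upward climb of the word, read as a path that starts from height \<open>0\<close>: every
  column has one horizontal border at its bottom and one at its top, and
  the vertical borders count the climbs and the descents, which have equal sums because the path
  returns to height \<open>0\<close> (\<open>semiperimeter_eq_length_plus_climb\<close>). Putting \<open>u\<close> on top of a bottom
  row adds \<open>1\<close> to the climb and the first column adds \<open>1\<close> to the length. A nonempty \<open>v\<close> contributes its
  length and its climb without the initial step from \<open>0\<close> to \<open>1\<close>, since it is reached from above. Hence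
  \<open>S = p\<^sup>2 x + p\<^sup>2 x S + p x S\<^sup>2\<close> (\<open>motzkin_sper_gf_quadratic\<close>).

  Completing the square, \<open>1 - p\<^sup>2 x - 2 p x S\<close> is a square root of the discriminant with constant
  coefficient \<open>1\<close>, and a power series has only one such root (\<open>fps_sqrt_unique\<close>).
\<close>


section \<open>The semiperimeter as length plus climb\<close>

fun climb :: "nat \<Rightarrow> nat list \<Rightarrow> nat" where
  "climb a [] = 0"
| "climb a (x # xs) = (x - a) + climb x xs"

lemma climb_append: "climb a (xs @ ys) = climb a xs + climb (last (a # xs)) ys"
  by (induction xs arbitrary: a) auto

lemma climb_map_Suc: "climb (Suc a) (map Suc xs) = climb a xs"
  by (induction xs arbitrary: a) auto

lemma climb_eq_sum: "climb a xs = (\<Sum>i<length xs. xs ! i - (a # xs) ! i)"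
  by (induction xs arbitrary: a)
     (simp_all add: sum.lessThan_Suc_shift del: sum.lessThan_Suc)

text \<open>
  Both sides are turned into sums of maxima: \<open>(a - b) + b = (b - a) + a\<close> for truncated subtraction,
  and the heights before and after the steps have the same sum, because they are the same letters
  together with an extra \<open>0\<close> at one end.
\<close>
lemma sum_descents_eq_sum_ascents:
  fixes w :: "nat list"
  shows "(\<Sum>i\<le>length w. (0 # w) ! i - (w @ [0]) ! i) = (\<Sum>i\<le>length w. (w @ [0]) ! i - (0 # w) ! i)"
proof -
  have sums: "(\<Sum>i\<le>length w. (w @ [0]) ! i) = (\<Sum>i\<le>length w. (0 # w) ! i)"
  proof -
    have "(\<Sum>i\<le>length w. xs ! i) = sum_list xs" if "length xs = Suc (length w)" for xs :: "nat list"
      using that by (simp add: sum_list_sum_nth atLeast0LessThan lessThan_Suc_atMost)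
    from this[of "w @ [0]"] this[of "0 # w"] show ?thesis by simp
  qed
  have "(\<Sum>i\<le>length w. (0 # w) ! i - (w @ [0]) ! i) + (\<Sum>i\<le>length w. (w @ [0]) ! i)
      = (\<Sum>i\<le>length w. (w @ [0]) ! i - (0 # w) ! i) + (\<Sum>i\<le>length w. (0 # w) ! i)"
    unfolding sum.distrib[symmetric] by (rule sum.cong) auto
  with sums show ?thesis by simp
qed

text \<open>
  A segment is a border exactly if one of its two sides lies in the polyomino and the other does not.
  On each of the lines between columns this leaves as many vertical borders as the two
  heights differ, so there are climbs plus descents of them, that is, twice the climb. Since no letter
  is \<open>0\<close>, the bottom and the top border of a column are distinct.
\<close>
lemma semiperimeter_eq_length_plus_climb:
  assumes "0 \<notin> set w"
  shows "semiperimeter w = length w + climb 0 w"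
proof -
  let ?n = "length w"
  let ?B = "{e. \<exists>c\<in>polyomino w. e \<in> cell_borders c \<and>
                (\<forall>c'\<in>polyomino w. c' \<noteq> c \<longrightarrow> e \<notin> cell_borders c')}"
  \<comment> \<open>The vertical borders on the line between columns \<open>i - 1\<close> and \<open>i\<close> lie between the two column heights,
      where the positions before the first and after the last column count as columns of height \<open>0\<close>.\<close>
  define gap where "gap i = {(w @ [0]) ! i..<(0 # w) ! i} \<union> {(0 # w) ! i..<(w @ [0]) ! i}" for i
  define bottom where "bottom = (\<lambda>i. Hor (int i) 0) ` {..<?n}"
  define top where "top = (\<lambda>i. Hor (int i) (int (w ! i))) ` {..<?n}"
  define ver where "ver = (\<lambda>(i, j). Ver (int i) (int j)) ` Sigma {..?n} gap"
  have pos: "0 < w ! i" if "i < ?n" for i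
    using assms that by (metis gr0I nth_mem)
  have cell: "(a, b) \<in> polyomino w \<longleftrightarrow> 0 \<le> a \<and> a < int ?n \<and> 0 \<le> b \<and> b < int (w ! nat a)" for a b
  proof
    assume "0 \<le> a \<and> a < int ?n \<and> 0 \<le> b \<and> b < int (w ! nat a)"
    then show "(a, b) \<in> polyomino w"
      unfolding polyomino_def by (intro CollectI exI[of _ "nat a"] exI[of _ "nat b"]) auto
  qed (auto simp: polyomino_def)
  have cell_Hor: "Hor i j \<in> cell_borders c \<longleftrightarrow> c = (i, j) \<or> c = (i, j - 1)" for i j c
    by (cases c) auto
  have cell_Ver: "Ver i j \<in> cell_borders c \<longleftrightarrow> c = (i, j) \<or> c = (i - 1, j)" for i j c
    by (cases c) auto
  have B_Hor: "Hor i j \<in> ?B \<longleftrightarrow> ((i, j) \<in> polyomino w) \<noteq> ((i, j - 1) \<in> polyomino w)" for i j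
    unfolding mem_Collect_eq cell_Hor by auto
  have B_Ver: "Ver i j \<in> ?B \<longleftrightarrow> ((i, j) \<in> polyomino w) \<noteq> ((i - 1, j) \<in> polyomino w)" for i j
    unfolding mem_Collect_eq cell_Ver by auto
  have hor_iff: "Hor i j \<in> ?B \<longleftrightarrow> Hor i j \<in> bottom \<union> top" for i j
  proof (cases "0 \<le> i \<and> i < int ?n")
    case True
    then obtain k where k: "i = int k" "k < ?n"
      by (metis int_ops(1) of_nat_less_iff zero_le_imp_eq_int)
    have "Hor i j \<in> ?B \<longleftrightarrow> j = 0 \<or> j = int (w ! k)"
      unfolding B_Hor cell using k pos[of k] by auto
    also have "\<dots> \<longleftrightarrow> Hor i j \<in> bottom \<union> top"
      using k by (auto simp: bottom_def top_def)
    finally show ?thesis .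
  next
    case False
    then show ?thesis
      unfolding B_Hor cell by (auto simp: bottom_def top_def)
  qed
  have right_cell: "(int k, int l) \<in> polyomino w \<longleftrightarrow> l < (w @ [0]) ! k" if "k \<le> ?n" for k l
    unfolding cell using that by (auto simp: nth_append)
  have left_cell: "(int k - 1, int l) \<in> polyomino w \<longleftrightarrow> l < (0 # w) ! k" if "k \<le> ?n" for k l
    unfolding cell using that by (cases k) auto
  have ver_iff: "Ver i j \<in> ?B \<longleftrightarrow> Ver i j \<in> ver" for i j
  proof (cases "0 \<le> i \<and> i \<le> int ?n \<and> 0 \<le> j")
    case True
    then obtain k l where kl: "i = int k" "k \<le> ?n" "j = int l"
      by (metis of_nat_le_iff zero_le_imp_eq_int)
    have "Ver i j \<in> ?B \<longleftrightarrow> l \<in> gap k"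
      unfolding B_Ver using kl by (auto simp: right_cell left_cell gap_def)
    also have "\<dots> \<longleftrightarrow> Ver i j \<in> ver"
      using kl by (auto simp: ver_def)
    finally show ?thesis .
  next
    case False
    then show ?thesis
      unfolding B_Ver cell by (auto simp: ver_def)
  qed
  have B: "?B = (bottom \<union> top) \<union> ver"
  proof (rule set_eqI)
    fix e
    show "e \<in> ?B \<longleftrightarrow> e \<in> (bottom \<union> top) \<union> ver"
    proof (cases e)
      case (Hor i j)
      have "Hor i j \<notin> ver" by (auto simp: ver_def)
      with hor_iff[of i j] Hor show ?thesis by blast
    next
      case (Ver i j)
      have "Ver i j \<notin> bottom \<union> top" by (auto simp: bottom_def top_def)
      with ver_iff[of i j] Ver show ?thesis by blast
    qed
  qed
  have fin: "finite bottom" "finite top" "finite ver"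
    by (auto simp: bottom_def top_def ver_def gap_def)
  have "card ?B = card bottom + card top + card ver"
    unfolding B
  proof (subst card_Un_disjoint)
    show "card (bottom \<union> top) + card ver = card bottom + card top + card ver"
      using fin by (subst card_Un_disjoint) (auto simp: bottom_def top_def dest: pos)
  qed (use fin in \<open>auto simp: bottom_def top_def ver_def\<close>)
  moreover have "card bottom = ?n" "card top = ?n"
    unfolding bottom_def top_def by (subst card_image; auto simp: inj_on_def)+
  moreover have "card ver = 2 * climb 0 w"
  proof -
    have "card ver = card (Sigma {..?n} gap)"
      unfolding ver_def by (rule card_image) (auto simp: inj_on_def)
    also have "\<dots> = (\<Sum>i\<le>?n. card (gap i))"
      by (rule card_SigmaI) (auto simp: gap_def)
    also have "\<dots> = (\<Sum>i\<le>?n. ((0 # w) ! i - (w @ [0]) ! i) + ((w @ [0]) ! i - (0 # w) ! i))"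
      unfolding gap_def by (intro sum.cong refl, subst card_Un_disjoint) auto
    also have "\<dots> = 2 * (\<Sum>i\<le>?n. (w @ [0]) ! i - (0 # w) ! i)"
      by (simp add: sum.distrib sum_descents_eq_sum_ascents)
    also have "(\<Sum>i\<le>?n. (w @ [0]) ! i - (0 # w) ! i) = climb 0 (w @ [0])"
      unfolding climb_eq_sum by (rule sum.cong) (auto simp: nth_append nth_Cons')
    also have "\<dots> = climb 0 w"
      by (simp add: climb_append)
    finally show ?thesis .
  qed
  ultimately show ?thesis
    by (simp add: semiperimeter_def perimeter_def)
qed


section \<open>Cutting a Motzkin word at its second letter 1\<close>

definition motzkin_step :: "nat \<Rightarrow> nat \<Rightarrow> bool" where
  "motzkin_step a b \<longleftrightarrow> 1 \<le> b \<and> b \<le> a + 1 \<and> a \<noteq> b"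

lemma motzkin_words_iff_successively:
  "w \<in> motzkin_words n \<longleftrightarrow> length w = n \<and> w \<noteq> [] \<and> hd w = 1 \<and> successively motzkin_step w"
proof -
  have step: "(\<forall>k. 1 \<le> k \<and> k < n \<longrightarrow> motzkin_step (w ! (k - 1)) (w ! k)) \<longleftrightarrow>
              (\<forall>k. Suc k < n \<longrightarrow> motzkin_step (w ! k) (w ! Suc k))" (is "?A \<longleftrightarrow> ?B")
  proof
    assume A: ?A
    show ?B
    proof (intro allI impI)
      fix k assume "Suc k < n"
      with A[rule_format, of "Suc k"] show "motzkin_step (w ! k) (w ! Suc k)" by simp
    qed
  next
    assume B: ?B
    show ?A
    proof (intro allI impI)
      fix k assume k: "1 \<le> k \<and> k < n"
      then have "Suc (k - 1) = k" by simp
      with k B[rule_format, of "k - 1"] show "motzkin_step (w ! (k - 1)) (w ! k)" by simp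
    qed
  qed
  have "w \<in> motzkin_words n \<longleftrightarrow> 1 \<le> n \<and> length w = n \<and> w ! 0 = 1 \<and>
          (\<forall>k. 1 \<le> k \<and> k < n \<longrightarrow> motzkin_step (w ! (k - 1)) (w ! k))"
    unfolding motzkin_words_def motzkin_step_def mem_Collect_eq ..
  also have "\<dots> \<longleftrightarrow> length w = n \<and> w \<noteq> [] \<and> w ! 0 = 1 \<and>
          (\<forall>k. Suc k < n \<longrightarrow> motzkin_step (w ! k) (w ! Suc k))"
    unfolding step by (cases w) auto
  also have "\<dots> \<longleftrightarrow> length w = n \<and> w \<noteq> [] \<and> hd w = 1 \<and> successively motzkin_step w"
    unfolding successively_conv_nth by (metis hd_conv_nth)
  finally show ?thesis .
qed

lemma zero_notin_motzkin_word: "w \<in> motzkin_words n \<Longrightarrow> 0 \<notin> set w"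
proof -
  have "successively motzkin_step w \<Longrightarrow> w \<noteq> [] \<Longrightarrow> hd w \<noteq> 0 \<Longrightarrow> 0 \<notin> set w"
    by (induction w rule: induct_list012) (auto simp: motzkin_step_def)
  then show "w \<in> motzkin_words n \<Longrightarrow> 0 \<notin> set w"
    by (auto simp: motzkin_words_iff_successively)
qed

lemma motzkin_words_0: "motzkin_words 0 = {}"
  by (auto simp: motzkin_words_def)

lemma motzkin_words_1: "motzkin_words (Suc 0) = {[1]}"
  by (auto simp: motzkin_words_iff_successively length_Suc_conv)

definition arch_append :: "nat list \<times> nat list \<Rightarrow> nat list" where
  "arch_append = (\<lambda>(u, v). 1 # map Suc u @ v)"

lemma successively_map_Suc:
  assumes "0 \<notin> set u"
  shows "successively motzkin_step (map Suc u) \<longleftrightarrow> successively motzkin_step u"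
  using assms by (induction u rule: induct_list012) (auto simp: motzkin_step_def)

text \<open>
  The last letter of \<open>map Suc u\<close> is at least \<open>2\<close>, so the first letter \<open>1\<close> of \<open>v\<close> may follow it.
\<close>
lemma arch_append_in_motzkin_words:
  assumes u: "u \<in> motzkin_words m" and v: "v = [] \<or> v \<in> motzkin_words k"
  shows "arch_append (u, v) \<in> motzkin_words (Suc (m + length v))"
proof -
  from u have u': "u \<noteq> []" "hd u = 1" "successively motzkin_step u" "length u = m"
    by (auto simp: motzkin_words_iff_successively)
  have "last u \<noteq> 0"
    using zero_notin_motzkin_word[OF u] u'(1) last_in_set by metis
  then have "v \<noteq> [] \<Longrightarrow> motzkin_step (last (map Suc u)) (hd v)"
    using u' v by (auto simp: motzkin_words_iff_successively motzkin_step_def last_map)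
  with u' v show ?thesis
    using successively_map_Suc[OF zero_notin_motzkin_word[OF u]]
    by (auto simp: arch_append_def motzkin_words_iff_successively successively_append_iff
        successively_Cons hd_append hd_map motzkin_step_def)
qed

text \<open>
  The cut is made before the second letter \<open>1\<close>, or at the end if there is none. The letter after the
  initial \<open>1\<close> can only be \<open>2\<close>, and all further letters before the cut are at least \<open>2\<close>, so lowering them by
  \<open>1\<close> gives a nonempty Motzkin word.
\<close>
lemma motzkin_word_cases:
  assumes w: "w \<in> motzkin_words (Suc n)" and n: "0 < n"
  obtains u v where "w = arch_append (u, v)" "u \<in> motzkin_words (length u)"
    "v = [] \<or> v \<in> motzkin_words (length v)" "n = length u + length v"
proof -
  from w obtain r where r: "w = 1 # r" "length r = n" "successively motzkin_step w"
    by (cases w) (auto simp: motzkin_words_iff_successively)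
  define a where "a = takeWhile (\<lambda>x. x \<noteq> 1) r"
  define v where "v = dropWhile (\<lambda>x. x \<noteq> 1) r"
  define u where "u = map (\<lambda>x. x - 1) a"
  have rav: "r = a @ v" by (simp add: a_def v_def)
  have "r \<noteq> []" using r n by auto
  with r have "hd r = 2" by (auto simp: successively_Cons motzkin_step_def)
  with \<open>r \<noteq> []\<close> have a: "a \<noteq> []" "hd a = 2" by (cases r; auto simp: a_def)+
  have big: "2 \<le> x" if "x \<in> set a" for x
  proof -
    have "x \<noteq> 1" using that unfolding a_def by (auto dest: set_takeWhileD)
    moreover have "x \<noteq> 0"
      using zero_notin_motzkin_word[OF w] that r rav by (auto intro: gr0I)
    ultimately show ?thesis by linarith
  qed
  have au: "map Suc u = a"
    unfolding u_def map_map by (rule map_idI) (use big in force)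
  have pos: "0 \<notin> set u" unfolding u_def using big by force
  have succ: "successively motzkin_step a" "successively motzkin_step v"
    using r rav by (auto simp: successively_Cons successively_append_iff)
  have "u \<in> motzkin_words (length u)"
    using succ(1) a successively_map_Suc[OF pos] unfolding au
    by (auto simp: motzkin_words_iff_successively u_def hd_map)
  moreover have "v = [] \<or> v \<in> motzkin_words (length v)"
    using succ(2) hd_dropWhile[of "\<lambda>x. x \<noteq> 1" r]
    by (auto simp: motzkin_words_iff_successively v_def)
  moreover have "n = length u + length v"
    using r(2) by (simp add: rav u_def)
  moreover have "w = arch_append (u, v)"
    by (simp add: arch_append_def au r(1) rav)
  ultimately show ?thesis using that by blast
qed

text \<open>
  There is no word of length \<open>0\<close>, so the terms \<open>i = 0\<close> and \<open>i = n\<close> of the union are empty. They are kept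
  because the union then has the shape of the \<open>n\<close>-th coefficient of a Cauchy product.
\<close>
lemma motzkin_words_Suc:
  assumes "0 < n"
  shows "motzkin_words (Suc n) =
    arch_append ` (motzkin_words n \<times> {[]} \<union> (\<Union>i\<le>n. motzkin_words i \<times> motzkin_words (n - i)))"
    (is "?L = arch_append ` ?R")
proof (intro set_eqI iffI)
  fix w assume "w \<in> ?L"
  then obtain u v where uv: "w = arch_append (u, v)" "u \<in> motzkin_words (length u)"
    "v = [] \<or> v \<in> motzkin_words (length v)" "n = length u + length v"
    using assms by (rule motzkin_word_cases)
  have "(u, v) \<in> ?R"
  proof (cases "v = []")
    case False
    with uv show ?thesis
      by (intro UnI2 UN_I[of "length u"]) auto
  qed (use uv in auto)
  with uv(1) show "w \<in> arch_append ` ?R" by blast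
next
  fix w assume "w \<in> arch_append ` ?R"
  then obtain u v where w: "w = arch_append (u, v)" and "(u, v) \<in> ?R" by auto
  then consider "u \<in> motzkin_words n" "v = []"
    | i where "i \<le> n" "u \<in> motzkin_words i" "v \<in> motzkin_words (n - i)" by auto
  then show "w \<in> ?L"
  proof cases
    case 1
    with arch_append_in_motzkin_words[of u n v] w show ?thesis by simp
  next
    case 2
    then have "i + length v = n" by (simp add: motzkin_words_iff_successively)
    with arch_append_in_motzkin_words[of u i v "n - i"] 2 w show ?thesis by simp
  qed
qed

text \<open>
  The raised letters \<open>map Suc u\<close> all differ from \<open>1\<close>, whereas \<open>v\<close> begins with \<open>1\<close> unless it is empty, so
  \<open>u\<close> can be read off as the part before the second letter \<open>1\<close>.
\<close>
lemma inj_on_arch_append: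
  "inj_on arch_append {(u, v). 0 \<notin> set u \<and> (v = [] \<or> hd v = 1)}"
proof -
  have read: "takeWhile (\<lambda>x. x \<noteq> 1) (map Suc u @ v) = map Suc u"
    if "0 \<notin> set u" "v = [] \<or> hd v = 1" for u v :: "nat list"
  proof -
    have "takeWhile (\<lambda>x. x \<noteq> 1) (map Suc u @ v) = map Suc u @ takeWhile (\<lambda>x. x \<noteq> 1) v"
      using that(1) by (intro takeWhile_append2) auto
    also have "takeWhile (\<lambda>x. x \<noteq> 1) v = []"
      using that(2) by (cases v) auto
    finally show ?thesis by simp
  qed
  show ?thesis
  proof (rule inj_onI, clarify)
    fix u v u' v' :: "nat list"
    assume h: "0 \<notin> set u" "v = [] \<or> hd v = 1" "0 \<notin> set u'" "v' = [] \<or> hd v' = 1"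
      and eq: "arch_append (u, v) = arch_append (u', v')"
    from eq have eq': "map Suc u @ v = map Suc u' @ v'" by (simp add: arch_append_def)
    then have "map Suc u = map Suc u'" using read h by metis
    with eq' show "u = u' \<and> v = v'" by (simp add: inj_map_eq_map)
  qed
qed

lemma semiperimeter_arch:
  assumes "u \<in> motzkin_words m"
  shows "semiperimeter (arch_append (u, [])) = semiperimeter u + 2"
proof -
  have "0 \<notin> set (arch_append (u, []))" by (auto simp: arch_append_def)
  with zero_notin_motzkin_word[OF assms] show ?thesis
    using climb_map_Suc[of 0 u]
    by (simp add: semiperimeter_eq_length_plus_climb arch_append_def)
qed

text \<open>
  The climb of \<open>v\<close> on its own includes a step from \<open>0\<close> to \<open>1\<close>; after \<open>map Suc u\<close> that step is a descent.
  This loss cancels against the gain of \<open>1\<close> in the climb of \<open>u\<close>, so only the extra column remains.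
\<close>
lemma semiperimeter_arch_append:
  assumes u: "u \<in> motzkin_words m" and v: "v \<in> motzkin_words k"
  shows "semiperimeter (arch_append (u, v)) = semiperimeter u + semiperimeter v + 1"
proof -
  note pos = zero_notin_motzkin_word[OF u] zero_notin_motzkin_word[OF v]
  obtain v' where v': "v = 1 # v'"
    using v by (cases v) (auto simp: motzkin_words_iff_successively)
  have "0 \<notin> set (arch_append (u, v))" using pos by (auto simp: arch_append_def)
  with pos show ?thesis
    using climb_map_Suc[of 0 u]
    by (simp add: semiperimeter_eq_length_plus_climb arch_append_def climb_append v' last_map)
qed


section \<open>The quadratic equation and its solution\<close>

lemma motzkin_sper_gf_nth:
  "motzkin_sper_gf $ n = (\<Sum>w\<in>motzkin_words n. p_var ^ semiperimeter w)"
  by (simp add: motzkin_sper_gf_def motzkin_words_0)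

lemma motzkin_sper_gf_nth_1: "motzkin_sper_gf $ Suc 0 = p_var ^ 2"
  by (simp add: motzkin_sper_gf_nth motzkin_words_1 semiperimeter_eq_length_plus_climb
      numeral_2_eq_2)

lemma motzkin_sper_gf_nth_Suc:
  assumes "0 < n"
  shows "motzkin_sper_gf $ Suc n =
    p_var ^ 2 * motzkin_sper_gf $ n + p_var * (motzkin_sper_gf ^ 2) $ n"
proof -
  let ?A = "motzkin_words n \<times> {[]}"
  let ?B = "\<lambda>i. motzkin_words i \<times> motzkin_words (n - i)"
  let ?f = "\<lambda>x. p_var ^ semiperimeter (arch_append x)"
  have nonempty: "v \<noteq> []" "length v = k" if "v \<in> motzkin_words k" for v k
    using that by (auto simp: motzkin_words_iff_successively)
  have "?A \<union> (\<Union>i\<le>n. ?B i) \<subseteq> {(u, v). 0 \<notin> set u \<and> (v = [] \<or> hd v = 1)}"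
    by (auto dest: zero_notin_motzkin_word simp: motzkin_words_iff_successively)
  then have inj: "inj_on arch_append (?A \<union> (\<Union>i\<le>n. ?B i))"
    using inj_on_arch_append by (rule inj_on_subset[rotated])
  have "motzkin_sper_gf $ Suc n = sum ?f (?A \<union> (\<Union>i\<le>n. ?B i))"
    unfolding motzkin_sper_gf_nth motzkin_words_Suc[OF assms]
    by (subst sum.reindex[OF inj]) simp
  also have "\<dots> = sum ?f ?A + sum ?f (\<Union>i\<le>n. ?B i)"
    using nonempty by (intro sum.union_disjoint) (auto simp: finite_motzkin_words)
  also have "sum ?f ?A = p_var ^ 2 * motzkin_sper_gf $ n"
  proof -
    have "sum ?f ?A = (\<Sum>u\<in>motzkin_words n. ?f (u, []))"
      unfolding sum.cartesian_product' by simp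
    also have "\<dots> = (\<Sum>u\<in>motzkin_words n. p_var ^ 2 * p_var ^ semiperimeter u)"
      by (intro sum.cong refl) (simp add: semiperimeter_arch power2_eq_square)
    finally show ?thesis
      by (simp add: motzkin_sper_gf_nth sum_distrib_left)
  qed
  also have "sum ?f (\<Union>i\<le>n. ?B i) = (\<Sum>i\<le>n. sum ?f (?B i))"
    by (intro sum.UNION_disjoint) (auto simp: finite_motzkin_words dest: nonempty(2))
  also have "\<dots> = (\<Sum>i\<le>n. p_var * (motzkin_sper_gf $ i * motzkin_sper_gf $ (n - i)))"
  proof (intro sum.cong refl)
    fix i
    have "sum ?f (?B i) = (\<Sum>u\<in>motzkin_words i. \<Sum>v\<in>motzkin_words (n - i).
        p_var * (p_var ^ semiperimeter u * p_var ^ semiperimeter v))"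
      unfolding sum.cartesian_product'
      by (intro sum.cong refl) (simp add: semiperimeter_arch_append power_add)
    then show "sum ?f (?B i) = p_var * (motzkin_sper_gf $ i * motzkin_sper_gf $ (n - i))"
      unfolding motzkin_sper_gf_nth sum_product by (simp only: sum_distrib_left)
  qed
  also have "\<dots> = p_var * (motzkin_sper_gf ^ 2) $ n"
    by (simp add: power2_eq_square fps_mult_nth sum_distrib_left atLeast0AtMost)
  finally show ?thesis .
qed

lemma motzkin_sper_gf_quadratic:
  "motzkin_sper_gf = fps_X * (fps_const (p_var ^ 2) + fps_const (p_var ^ 2) * motzkin_sper_gf
     + fps_const p_var * motzkin_sper_gf ^ 2)"
proof (rule fps_ext)
  fix n
  have zero: "motzkin_sper_gf $ 0 = 0" by (simp add: motzkin_sper_gf_def)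
  consider "n = 0" | "n = Suc 0" | m where "n = Suc m" "0 < m"
    by (metis not0_implies_Suc gr0I)
  then show "motzkin_sper_gf $ n = (fps_X * (fps_const (p_var ^ 2)
      + fps_const (p_var ^ 2) * motzkin_sper_gf + fps_const p_var * motzkin_sper_gf ^ 2)) $ n"
  proof cases
    case 2
    then show ?thesis
      by (simp add: zero motzkin_sper_gf_nth_1 power2_eq_square)
  next
    case (3 m)
    then show ?thesis
      by (simp add: motzkin_sper_gf_nth_Suc)
  qed (simp add: zero)
qed

lemma fps_sqrt_unique:
  fixes f g :: "'a::field_char_0 fps"
  assumes "g ^ 2 = f" and "g $ 0 = 1"
  shows "fps_sqrt f = g"
proof -
  have "f $ 0 = 1" using assms by (simp add: power2_eq_square flip: assms(1))
  then have "(fps_sqrt f - g) * (fps_sqrt f + g) = 0"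
    using fps_sqrt_power2[of f] assms(1) by (simp add: algebra_simps power2_eq_square)
  \<comment> \<open>The other root \<open>- g\<close> is excluded by the constant coefficients, whose sum is \<open>2\<close>.\<close>
  moreover have "(fps_sqrt f + g) $ 0 \<noteq> 0"
    by (simp add: fps_sqrt_nth_0 assms(2))
  then have "fps_sqrt f + g \<noteq> 0" by (metis fps_zero_nth)
  ultimately show ?thesis by simp
qed

theorem theorem4p1:
  shows "motzkin_sper_gf =
    (let x = fps_X; p = fps_const p_var in
      (1 - p^2 * x - fps_sqrt (1 - 2 * p^2 * x - 4 * p^3 * x^2 + p^4 * x^2)) / (2 * p * x))"
proof -
  define x :: "rat poly fract fps" where "x = fps_X"
  define p where "p = fps_const p_var"
  define S where "S = motzkin_sper_gf"
  have S: "S = x * (p^2 + p^2 * S + p * S^2)"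
    using motzkin_sper_gf_quadratic by (simp add: S_def x_def p_def)
  have "(1 - p^2 * x - 2 * p * x * S)^2
      = (1 - p^2 * x)^2 - 4 * p * x * (S - x * (p^2 * S + p * S^2))"
    by (simp add: algebra_simps power2_eq_square)
  also have "S - x * (p^2 * S + p * S^2) = x * p^2"
    using S by (simp add: algebra_simps)
  also have "(1 - p^2 * x)^2 - 4 * p * x * (x * p^2)
      = 1 - 2 * p^2 * x - 4 * p^3 * x^2 + p^4 * x^2"
    by (simp add: algebra_simps power2_eq_square power3_eq_cube power4_eq_xxxx)
  finally have "fps_sqrt (1 - 2 * p^2 * x - 4 * p^3 * x^2 + p^4 * x^2) = 1 - p^2 * x - 2 * p * x * S"
    by (rule fps_sqrt_unique) (simp add: x_def)
  then have "1 - p^2 * x - fps_sqrt (1 - 2 * p^2 * x - 4 * p^3 * x^2 + p^4 * x^2) = 2 * p * x * S"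
    by simp
  moreover have "2 * p * x \<noteq> 0"
    by (simp add: p_def x_def p_var_def)
  ultimately have "S =
      (1 - p^2 * x - fps_sqrt (1 - 2 * p^2 * x - 4 * p^3 * x^2 + p^4 * x^2)) / (2 * p * x)"
    by simp
  then show ?thesis
    by (simp only: Let_def S_def x_def p_def)
qed

end
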